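(* If $D$ is a finite in-semicomplete digraph, then $D$ is $\alpha$-diperfect.
   Context: Digraphs have no loops and no parallel arcs, but may contain both arcs $uv$ and $vu$ (cycles of length two). Two vertices $u,v$ are adjacent if $uv$ or $vu$ is an arc. A digraph is semicomplete if every two distinct vertices are adjacent. A digraph $D$ is in-semicomplete (locally in-semicomplete) if for every vertex $v$ the set of in-neighbors of $v$ induces a semicomplete digraph. A stable set is a set of pairwise non-adjacent vertices; it is maximum if no stable set has larger cardinality. A path of $D$ is a directed path, i.e. a sequence $v_1v_2\cdots v_\ell$ of distinct vertices ($\ell\ge 1$) with $v_iv_{i+1}\in A(D)$ for $1\le i<\ell$. A path partition of $D$ is a collection of paths whose vertex sets partition $V(D)$. For a stable set $S$, an $S$-path partition of $D$ is a path partition $\mathcal P$ with $|V(P)\cap S|=1$ for all $P\in\mathcal P$. A digraph satisfies the $\alpha$-property if it has an $S$-path partition for every maximum stable set $S$. A digraph is $\alpha$-diperfect if every induced subdigraph of it satisfies the $\alpha$-property. *)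

theory Defs
  imports "Graph_Theory.Graph_Theory" "HOL-Library.Disjoint_Sets"
begin

definition adjacent :: "('a,'b) pre_digraph \<Rightarrow> 'a \<Rightarrow> 'a \<Rightarrow> bool" where
  "adjacent D u v \<longleftrightarrow> u \<rightarrow>\<^bsub>D\<^esub> v \<or> v \<rightarrow>\<^bsub>D\<^esub> u"

definition semicomplete :: "('a,'b) pre_digraph \<Rightarrow> bool" where
  "semicomplete D \<longleftrightarrow> pairwise (adjacent D) (verts D)"

definition in_neighbors :: "('a,'b) pre_digraph \<Rightarrow> 'a \<Rightarrow> 'a set" where
  "in_neighbors D v = {u. u \<rightarrow>\<^bsub>D\<^esub> v}"

definition in_semicomplete :: "('a,'b) pre_digraph \<Rightarrow> bool" where
  "in_semicomplete D \<longleftrightarrow> (\<forall>v\<in>verts D. semicomplete (D \<restriction> in_neighbors D v))"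

definition stable_set :: "('a,'b) pre_digraph \<Rightarrow> 'a set \<Rightarrow> bool" where
  "stable_set D S \<longleftrightarrow> S \<subseteq> verts D \<and> pairwise (\<lambda>u v. \<not> adjacent D u v) S"

text \<open>The comparison by \<^const>\<open>card\<close> is meaningful for finite digraphs only.\<close>

definition maximum_stable_set :: "('a,'b) pre_digraph \<Rightarrow> 'a set \<Rightarrow> bool" where
  "maximum_stable_set D S \<longleftrightarrow>
     stable_set D S \<and> (\<forall>T. stable_set D T \<longrightarrow> card T \<le> card S)"

text \<open>
  A path is given by its list of vertices. \<^const>\<open>vpath\<close> requires this list to be nonempty,
  so together with disjointness the vertex sets of the paths form a partition, and distinct
  paths of the collection have distinct vertex sets.
\<close>

definition path_partition :: "('a,'b) pre_digraph \<Rightarrow> 'a list set \<Rightarrow> bool" where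
  "path_partition D \<P> \<longleftrightarrow>
     (\<forall>P\<in>\<P>. vpath P D) \<and> disjoint_family_on set \<P> \<and> (\<Union>P\<in>\<P>. set P) = verts D"

definition S_path_partition :: "('a,'b) pre_digraph \<Rightarrow> 'a set \<Rightarrow> 'a list set \<Rightarrow> bool" where
  "S_path_partition D S \<P> \<longleftrightarrow>
     path_partition D \<P> \<and> (\<forall>P\<in>\<P>. card (set P \<inter> S) = 1)"

definition alpha_property :: "('a,'b) pre_digraph \<Rightarrow> bool" where
  "alpha_property D \<longleftrightarrow> (\<forall>S. maximum_stable_set D S \<longrightarrow> (\<exists>\<P>. S_path_partition D S \<P>))"

definition alpha_diperfect :: "('a,'b) pre_digraph \<Rightarrow> bool" where
  "alpha_diperfect D \<longleftrightarrow> (\<forall>H. induced_subgraph H D \<longrightarrow> alpha_property H)"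

end

theory Submission
  imports Defs
begin

text \<open>
  Why the theorem holds. An induced subdigraph of an in-semicomplete digraph is again
  in-semicomplete, so it suffices to find an \<open>S\<close>-path partition for a maximum stable set \<open>S\<close>.
  Two features of in-semicomplete digraphs do the work.

  \<^item> Paths absorb their in-neighbours: a vertex \<open>w\<close> with an arc into a path \<open>P\<close> can be inserted
    into \<open>P\<close>, just before the first out-neighbour of \<open>w\<close> on \<open>P\<close> (\<open>vpath_absorb\<close>). Consequently
    disjoint paths that meet \<open>S\<close> once each and together contain \<open>S\<close> grow to an \<open>S\<close>-path
    partition as soon as every vertex reaches one of them (\<open>S_path_partition_grow\<close>).

  \<^item> A vertex has at most one in-neighbour in a stable set.

  The single vertices of \<open>S\<close> would serve as initial paths if every vertex reached \<open>S\<close>. In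
  general, let \<open>T\<close> be a minimal set such that every vertex reaches \<open>S \<union> T\<close>. Minimality makes
  \<open>T\<close> disjoint from \<open>S\<close> and forbids arcs from \<open>T\<close> to \<open>S \<union> T\<close> (\<open>ex_minimal_targets\<close>). As \<open>S\<close> is
  maximum, each \<open>t \<in> T\<close> has an in-neighbour in \<open>S\<close>, unique by the second feature; two vertices
  of \<open>T\<close> cannot share it, as exchanging it for both of them would enlarge \<open>S\<close>. Hence \<open>T\<close> is
  matched into \<open>S\<close> by arcs \<open>s \<rightarrow> t\<close> (\<open>ex_matching_into_max_stable\<close>), and these arcs together
  with the unmatched vertices of \<open>S\<close> are initial paths that every vertex reaches.
\<close>

lemma in_semicompleteD:
  assumes "wf_digraph G" "in_semicomplete G"
    and "u \<rightarrow>\<^bsub>G\<^esub> x" "v \<rightarrow>\<^bsub>G\<^esub> x" "u \<noteq> v"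
  shows "adjacent G u v"
proof -
  interpret wf_digraph G by fact
  have "x \<in> verts G" using assms(3) by (rule adj_in_verts)
  then have "adjacent (G \<restriction> in_neighbors G x) u v"
    using assms(2-5)
    by (auto simp: in_semicomplete_def semicomplete_def pairwise_def in_neighbors_def)
  then show ?thesis
    unfolding adjacent_def by (auto dest: dominates_induce_subgraphD)
qed

lemma in_semicomplete_induced:
  assumes "wf_digraph G" "in_semicomplete G" "induced_subgraph H G"
  shows "in_semicomplete H"
proof -
  have compat: "tail H = tail G" "head H = head G" "verts H \<subseteq> verts G"
    and arcs: "arcs H = {e \<in> arcs G. tail G e \<in> verts H \<and> head G e \<in> verts H}"
    using assms(3) by (auto simp: induced_subgraph_def subgraph_def compatible_def)
  have adj_H: "u \<rightarrow>\<^bsub>H\<^esub> v \<longleftrightarrow> u \<rightarrow>\<^bsub>G\<^esub> v \<and> u \<in> verts H \<and> v \<in> verts H" for u v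
    by (auto simp: arcs_ends_def arc_to_ends_def compat arcs)
  have adj_H_in: "u \<rightarrow>\<^bsub>H \<restriction> X\<^esub> v \<longleftrightarrow> u \<rightarrow>\<^bsub>H\<^esub> v \<and> u \<in> X \<and> v \<in> X" for u v X
    by (auto simp: arcs_ends_def arc_to_ends_def)
  show ?thesis
    unfolding in_semicomplete_def semicomplete_def pairwise_def
  proof (intro ballI impI)
    fix x u v
    assume "u \<in> verts (H \<restriction> in_neighbors H x)" "v \<in> verts (H \<restriction> in_neighbors H x)" "u \<noteq> v"
    then have "u \<rightarrow>\<^bsub>H\<^esub> x" "v \<rightarrow>\<^bsub>H\<^esub> x" by (auto simp: in_neighbors_def)
    moreover from this have "adjacent G u v"
      using in_semicompleteD[OF assms(1,2)] \<open>u \<noteq> v\<close> by (auto simp: adj_H)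
    ultimately show "adjacent (H \<restriction> in_neighbors H x) u v"
      by (auto simp: adjacent_def adj_H_in adj_H in_neighbors_def)
  qed
qed

text \<open>
  Let \<open>x\<close> be the first out-neighbour of \<open>w\<close> on the path and \<open>u\<close> its predecessor on the path.
  Both \<open>u\<close> and \<open>w\<close> are in-neighbours of \<open>x\<close>, hence adjacent, and the choice of \<open>x\<close> leaves only
  the arc \<open>u \<rightarrow> w\<close>. So \<open>w\<close> fits between \<open>u\<close> and \<open>x\<close>.
\<close>

lemma vpath_absorb:
  assumes "wf_digraph G" "in_semicomplete G" "vpath P G"
    and "w \<notin> set P" "v \<in> set P" "w \<rightarrow>\<^bsub>G\<^esub> v"
  shows "\<exists>Q. vpath Q G \<and> set Q = insert w (set P)"
proof -
  interpret wf_digraph G by fact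
  obtain ys x zs where P: "P = ys @ x # zs" and wx: "w \<rightarrow>\<^bsub>G\<^esub> x"
    and first: "\<forall>y\<in>set ys. \<not> w \<rightarrow>\<^bsub>G\<^esub> y"
    using split_list_first_prop[of P "\<lambda>y. w \<rightarrow>\<^bsub>G\<^esub> y"] assms(5,6) by blast
  have walk: "vwalk (ys @ x # zs) G" and dist: "distinct (ys @ x # zs)"
    using assms(3) P by (simp_all add: vpath_def)
  have "vwalk (x # zs) G" using walk by (rule vwalkI_append_r[rotated]) simp
  then have tail_walk: "vwalk (w # x # zs) G"
    using wx vwalk_wf_digraph_consI[of "x # zs" w] by simp
  have "vwalk (ys @ w # x # zs) G"
  proof (cases "ys = []")
    case False
    have "last ys \<rightarrow>\<^bsub>G\<^esub> x"
      using walk False by (auto simp: vwalk_def vwalk_arcs_append)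
    moreover have "last ys \<noteq> w" using False assms(4) P by auto
    ultimately have "adjacent G (last ys) w"
      using in_semicompleteD[OF assms(1,2)] wx by blast
    then have "last ys \<rightarrow>\<^bsub>G\<^esub> w" using first False by (auto simp: adjacent_def)
    then show ?thesis
      using walk tail_walk False by (auto simp: vwalk_def vwalk_arcs_append)
  qed (use tail_walk in simp)
  moreover have "distinct (ys @ w # x # zs)" using dist assms(4) P by auto
  ultimately have "vpath (ys @ w # x # zs) G" by blast
  then show ?thesis using P by (intro exI[of _ "ys @ w # x # zs"]) auto
qed

lemma reachable_crossing_arc:
  assumes "u \<rightarrow>\<^sup>*\<^bsub>G\<^esub> v" "wf_digraph G" "u \<notin> W" "v \<in> W"
  shows "\<exists>x y. x \<notin> W \<and> y \<in> W \<and> x \<rightarrow>\<^bsub>G\<^esub> y"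
  using assms(2) assms(1,3,4)
  by (induction rule: wf_digraph.converse_reachable_induct[consumes 2]) auto

text \<open>
  The paths are indexed by the vertex of \<open>S\<close> that they contain, and absorb the uncovered vertices
  one at a time. An absorbed vertex lies outside \<open>S\<close>, since \<open>S\<close> is covered from the beginning.
\<close>

lemma S_path_partition_grow:
  assumes "fin_digraph G" "in_semicomplete G"
    and "\<forall>s\<in>S. vpath (f s) G \<and> set (f s) \<inter> S = {s}"
    and "disjoint_family_on (\<lambda>s. set (f s)) S"
    and "\<forall>v\<in>verts G. \<exists>x\<in>(\<Union>s\<in>S. set (f s)). v \<rightarrow>\<^sup>*\<^bsub>G\<^esub> x"
  shows "\<exists>\<P>. S_path_partition G S \<P>"
  using assms(3-5)
proof (induction "card (verts G - (\<Union>s\<in>S. set (f s)))" arbitrary: f rule: less_induct)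
  case less
  interpret fin_digraph G by fact
  define W where "W = (\<Union>s\<in>S. set (f s))"
  have "W \<subseteq> verts G" using less.prems(1) by (auto simp: W_def vpath_def vwalk_def)
  show ?case
  proof (cases "W = verts G")
    case True
    have "disjoint_family_on set (f ` S)"
      using less.prems(2) unfolding disjoint_family_on_def by (metis imageE)
    then have "S_path_partition G S (f ` S)"
      using less.prems(1) True by (auto simp: S_path_partition_def path_partition_def W_def)
    then show ?thesis by blast
  next
    case False
    then obtain u where "u \<in> verts G" "u \<notin> W" using \<open>W \<subseteq> verts G\<close> by blast
    then obtain w v where w: "w \<notin> W" and v: "v \<in> W" and wv: "w \<rightarrow>\<^bsub>G\<^esub> v"
      using less.prems(3) reachable_crossing_arc[OF _ wf_digraph] unfolding W_def by metis
    obtain s where s: "s \<in> S" "v \<in> set (f s)" using v by (auto simp: W_def)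
    then obtain Q where Q: "vpath Q G" "set Q = insert w (set (f s))"
      using vpath_absorb[OF wf_digraph assms(2), of "f s" w v] less.prems(1) w wv
      by (auto simp: W_def)
    define f' where "f' = f(s := Q)"
    have union: "(\<Union>s\<in>S. set (f' s)) = insert w W"
      using Q(2) s(1) by (auto simp: f'_def W_def split: if_splits)
    have "w \<notin> S" using w less.prems(1) by (auto simp: W_def)
    then have "\<forall>s\<in>S. vpath (f' s) G \<and> set (f' s) \<inter> S = {s}"
      using less.prems(1) Q s(1) by (auto simp: f'_def)
    moreover have "disjoint_family_on (\<lambda>s. set (f' s)) S"
      using less.prems(2) Q(2) w s(1)
      by (auto simp: disjoint_family_on_def f'_def W_def)
    moreover have "\<forall>v\<in>verts G. \<exists>x\<in>(\<Union>s\<in>S. set (f' s)). v \<rightarrow>\<^sup>*\<^bsub>G\<^esub> x"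
      using less.prems(3) unfolding union W_def by blast
    moreover have "card (verts G - (\<Union>s\<in>S. set (f' s))) < card (verts G - W)"
      unfolding union using adj_in_verts(1)[OF wv] w by (intro psubset_card_mono) auto
    ultimately show ?thesis using less.hyps[of f'] unfolding W_def by blast
  qed
qed

text \<open>
  A vertex of \<open>T\<close> that lies in \<open>S\<close>, or has an arc to another vertex of \<open>S \<union> T\<close>, could be removed
  from \<open>T\<close>: whatever reaches it also reaches the rest.
\<close>

lemma ex_minimal_targets:
  assumes "fin_digraph G" "loopfree_digraph G"
  shows "\<exists>T \<subseteq> verts G - S. (\<forall>v\<in>verts G. \<exists>x\<in>S \<union> T. v \<rightarrow>\<^sup>*\<^bsub>G\<^esub> x) \<and>
           (\<forall>t\<in>T. \<forall>x\<in>S \<union> T. \<not> t \<rightarrow>\<^bsub>G\<^esub> x)"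
proof -
  interpret fin_digraph G by fact
  interpret loopfree_digraph G by fact
  define \<T> where "\<T> = {T. T \<subseteq> verts G \<and> (\<forall>v\<in>verts G. \<exists>x\<in>S \<union> T. v \<rightarrow>\<^sup>*\<^bsub>G\<^esub> x)}"
  have "finite \<T>" by (rule finite_subset[of _ "Pow (verts G)"]) (auto simp: \<T>_def)
  moreover have "verts G \<in> \<T>" by (auto simp: \<T>_def)
  ultimately obtain T where T: "T \<in> \<T>" and "\<forall>T'\<in>\<T>. T' \<subseteq> T \<longrightarrow> T = T'"
    using finite_has_minimal[of \<T>] by auto
  then have irredundant: "T - {t} \<notin> \<T>" if "t \<in> T" for t using that by auto
  have "t \<notin> S" if "t \<in> T" for t
  proof
    assume "t \<in> S"
    then have "S \<union> (T - {t}) = S \<union> T" by blast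
    then have "T - {t} \<in> \<T>" using T by (auto simp: \<T>_def)
    then show False using irredundant that by blast
  qed
  moreover have "\<not> t \<rightarrow>\<^bsub>G\<^esub> x" if "t \<in> T" "x \<in> S \<union> T" for t x
  proof
    assume tx: "t \<rightarrow>\<^bsub>G\<^esub> x"
    then have "x \<noteq> t" using adj_not_same by blast
    then have x: "x \<in> S \<union> (T - {t})" using that by blast
    have "\<exists>y\<in>S \<union> (T - {t}). v \<rightarrow>\<^sup>*\<^bsub>G\<^esub> y" if v: "v \<in> verts G" for v
    proof -
      obtain y where y: "y \<in> S \<union> T" "v \<rightarrow>\<^sup>*\<^bsub>G\<^esub> y" using T v by (auto simp: \<T>_def)
      show ?thesis
      proof (cases "y = t")
        case True
        then show ?thesis using y(2) tx x by (meson reachable_adj_trans)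
      qed (use y in blast)
    qed
    then have "T - {t} \<in> \<T>" using T by (auto simp: \<T>_def)
    then show False using irredundant that by blast
  qed
  ultimately show ?thesis using T by (intro exI[of _ T]) (auto simp: \<T>_def)
qed

text \<open>
  Both parts of the claim come from stable sets that would be larger than \<open>S\<close>: adding to \<open>S\<close> a
  vertex \<open>t\<close> without in-neighbour in \<open>S\<close>, or replacing a vertex of \<open>S\<close> by two vertices of \<open>T\<close>
  that it dominates. No counting condition in the style of Hall is needed, because the
  in-neighbour in \<open>S\<close> is unique.
\<close>

lemma ex_matching_into_max_stable:
  assumes "fin_digraph G" "in_semicomplete G" "maximum_stable_set G S"
    and T: "T \<subseteq> verts G - S" and no_arc: "\<forall>t\<in>T. \<forall>x\<in>S \<union> T. \<not> t \<rightarrow>\<^bsub>G\<^esub> x"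
  shows "\<exists>g. inj_on g T \<and> (\<forall>t\<in>T. g t \<in> S \<and> g t \<rightarrow>\<^bsub>G\<^esub> t)"
proof -
  interpret fin_digraph G by fact
  have S: "S \<subseteq> verts G" and stable: "\<And>u v. u \<in> S \<Longrightarrow> v \<in> S \<Longrightarrow> u \<noteq> v \<Longrightarrow> \<not> adjacent G u v"
    using assms(3) by (auto simp: maximum_stable_set_def stable_set_def pairwise_def)
  have max: "card X \<le> card S" if "stable_set G X" for X
    using assms(3) that by (auto simp: maximum_stable_set_def)
  have "finite S" using S by (rule finite_subset) simp
  have "\<exists>s\<in>S. s \<rightarrow>\<^bsub>G\<^esub> t" if t: "t \<in> T" for t
  proof (rule ccontr)
    assume "\<not> ?thesis"
    then have "stable_set G (insert t S)"
      using t T S no_arc stable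
      by (auto simp: stable_set_def pairwise_insert pairwise_def adjacent_def)
    moreover have "card (insert t S) = Suc (card S)" using \<open>finite S\<close> t T by auto
    ultimately show False using max by fastforce
  qed
  then obtain g where g: "\<And>t. t \<in> T \<Longrightarrow> g t \<in> S" "\<And>t. t \<in> T \<Longrightarrow> g t \<rightarrow>\<^bsub>G\<^esub> t"
    by metis
  \<comment> \<open>Two in-neighbours of \<open>t\<close> are adjacent, so they cannot both lie in the stable set \<open>S\<close>.\<close>
  have unique: "s = g t" if "t \<in> T" "s \<in> S" "s \<rightarrow>\<^bsub>G\<^esub> t" for s t
    using in_semicompleteD[OF wf_digraph assms(2)] g that stable by blast
  have "inj_on g T"
  proof (rule inj_onI, rule ccontr)
    fix t u assume tu: "t \<in> T" "u \<in> T" "g t = g u" "t \<noteq> u"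
    define X where "X = insert t (insert u (S - {g t}))"
    \<comment> \<open>By uniqueness, \<open>g t = g u\<close> was the only vertex of \<open>S\<close> adjacent to \<open>t\<close> or \<open>u\<close>.\<close>
    have "stable_set G X"
      using tu T S no_arc stable unique unfolding X_def
      by (auto simp: stable_set_def pairwise_insert pairwise_def adjacent_def)
    moreover have "card X = Suc (card S)"
      unfolding X_def using \<open>finite S\<close> tu T g(1)[OF tu(1)] card_Suc_Diff1[of S "g t"]
      by (subst card_insert_disjoint; force)
    ultimately show False using max by fastforce
  qed
  then show ?thesis using g by blast
qed

lemma in_semicomplete_alpha_property:
  assumes "digraph G" "in_semicomplete G"
  shows "alpha_property G"
  unfolding alpha_property_def
proof (intro allI impI)
  fix S assume S: "maximum_stable_set G S"
  interpret digraph G by fact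
  have fin: "fin_digraph G" and loopfree: "loopfree_digraph G" by unfold_locales
  obtain T where T: "T \<subseteq> verts G - S"
    and reach: "\<forall>v\<in>verts G. \<exists>x\<in>S \<union> T. v \<rightarrow>\<^sup>*\<^bsub>G\<^esub> x"
    and no_arc: "\<forall>t\<in>T. \<forall>x\<in>S \<union> T. \<not> t \<rightarrow>\<^bsub>G\<^esub> x"
    using ex_minimal_targets[OF fin loopfree] by meson
  obtain g where g: "inj_on g T" "\<And>t. t \<in> T \<Longrightarrow> g t \<in> S" "\<And>t. t \<in> T \<Longrightarrow> g t \<rightarrow>\<^bsub>G\<^esub> t"
    using ex_matching_into_max_stable[OF fin assms(2) S T no_arc] by blast
  define f where "f s = (if s \<in> g ` T then [s, inv_into T g s] else [s])" for s
  have f_matched: "f (g t) = [g t, t]" if "t \<in> T" for t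
    using that g(1) by (simp add: f_def)
  have set_f: "set (f s) = insert s {t \<in> T. g t = s}" for s
  proof (cases "s \<in> g ` T")
    case True
    then obtain t where t: "t \<in> T" "s = g t" by blast
    then have "{t' \<in> T. g t' = s} = {t}" using g(1) by (auto dest: inj_onD)
    then show ?thesis using t by (simp add: f_matched)
  qed (auto simp: f_def)
  have "S \<subseteq> verts G" using S by (auto simp: maximum_stable_set_def stable_set_def)
  have "vpath (f s) G" if s: "s \<in> S" for s
  proof (cases "s \<in> g ` T")
    case True
    then obtain t where t: "t \<in> T" "s = g t" by blast
    then have "s \<noteq> t" using s T by blast
    then show ?thesis
      using t g(3)[OF t(1)] T s \<open>S \<subseteq> verts G\<close> by (auto simp: f_matched vpath_def vwalk_def)
  next
    case False
    then show ?thesis using s \<open>S \<subseteq> verts G\<close> by (auto simp: f_def vpath_def vwalk_def)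
  qed
  then have "\<forall>s\<in>S. vpath (f s) G \<and> set (f s) \<inter> S = {s}"
    using T by (auto simp: set_f)
  moreover have "disjoint_family_on (\<lambda>s. set (f s)) S"
    using T by (auto simp: disjoint_family_on_def set_f)
  moreover have "(\<Union>s\<in>S. set (f s)) = S \<union> T"
    using g(2) by (auto simp: set_f)
  ultimately show "\<exists>\<P>. S_path_partition G S \<P>"
    using S_path_partition_grow[OF fin assms(2), of S f] reach by simp
qed

theorem theorem6p4:
  fixes D :: "('a,'b) pre_digraph"
  assumes "digraph D"
    and "in_semicomplete D"
  shows "alpha_diperfect D"
  unfolding alpha_diperfect_def
proof (intro allI impI)
  fix H assume H: "induced_subgraph H D"
  interpret digraph D by fact
  have "digraph H" using H by (rule digraphI_induced)
  moreover have "in_semicomplete H"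
    using wf_digraph assms(2) H by (rule in_semicomplete_induced)
  ultimately show "alpha_property H" by (rule in_semicomplete_alpha_property)
qed

end
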